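(* Let $X,Y$ be jointly distributed random variables taking values in finite sets $\mathcal{X}$ and $\mathcal{Y}$. Then for every $\varepsilon>0$ there exists a public-coin protocol in which Alice receives $x$ and Bob receives $y$, with the following properties: (1) for every pair $(x,y)$ in the support of $(X,Y)$, with probability at least $1-\varepsilon$ (over the public randomness) Bob outputs $x$; (2) the expected length of the communication (expectation over $(X,Y)$ and the public randomness) is at most $$H(X|Y)+2\sqrt{H(X|Y)}+\log_2\frac{1}{\varepsilon}+C,$$ where $C$ is an absolute constant.
   Context: $H(X|Y)=\sum_{x,y}\Pr[X=x,Y=y]\log_2\frac{1}{\Pr[X=x\mid Y=y]}$ is the conditional Shannon entropy. A public-coin protocol is a rooted binary tree; Alice and Bob share a random string $r$ independent of $(X,Y)$; at each non-leaf vertex owned by Alice (resp. Bob) the owner sends a bit that is a function of his/her input and $r$, and they follow the correspondingly labelled edge; at the leaf reached Bob outputs a value depending on the leaf, $y$ and $r$. The length of the communication on a given run is the depth of the leaf reached.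
   Formalization: The formal theorem takes 0 < ε ≤ 1, since for constant X and very large ε the claimed bound would be negative; the finite sets 𝒳 and 𝒴 are taken to be finite sets of natural numbers, which is only a relabelling. *)

theory Defs
  imports "HOL-Probability.Probability"
begin

(* The definitions are polymorphic in the alphabets. A claim about a constant that is independent
   of the alphabets has to fix their types, since HOL cannot quantify over types below an
   existential; finite sets of naturals lose no generality, as every finite set can be relabelled.

   Error probabilities range over 0 < epsilon <= 1: for large epsilon, log 2 (1 / epsilon) tends to
   minus infinity and cannot be part of an upper bound on a nonnegative length. *)

(* Pairs of probability 0 contribute 0 to the sum, the usual convention 0 * log (1 / 0) = 0. *)
definition cond_entropy :: "'x set \<Rightarrow> 'y set \<Rightarrow> ('x \<times> 'y) pmf \<Rightarrow> real" where
  "cond_entropy A B p =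
     (\<Sum>(x, y)\<in>A \<times> B. pmf p (x, y) *
        log 2 (1 / cond_prob (measure_pmf p) (\<lambda>\<omega>. fst \<omega> = x) (\<lambda>\<omega>. snd \<omega> = y)))"

(* A leaf carries Bob's output function; at an inner vertex the left subtree is entered on the
   bit False and the right subtree on True. *)
datatype ('x, 'y, 'r, 'out) protocol =
    Leaf "'y \<Rightarrow> 'r \<Rightarrow> 'out"
  | Alice "'x \<Rightarrow> 'r \<Rightarrow> bool" "('x, 'y, 'r, 'out) protocol" "('x, 'y, 'r, 'out) protocol"
  | Bob "'y \<Rightarrow> 'r \<Rightarrow> bool" "('x, 'y, 'r, 'out) protocol" "('x, 'y, 'r, 'out) protocol"

primrec bob_output :: "('x, 'y, 'r, 'out) protocol \<Rightarrow> 'x \<Rightarrow> 'y \<Rightarrow> 'r \<Rightarrow> 'out" where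
  "bob_output (Leaf g) x y r = g y r"
| "bob_output (Alice f t0 t1) x y r = (if f x r then bob_output t1 x y r else bob_output t0 x y r)"
| "bob_output (Bob f t0 t1) x y r = (if f y r then bob_output t1 x y r else bob_output t0 x y r)"

(* The depth of the leaf reached. *)
primrec comm_length :: "('x, 'y, 'r, 'out) protocol \<Rightarrow> 'x \<Rightarrow> 'y \<Rightarrow> 'r \<Rightarrow> nat" where
  "comm_length (Leaf g) x y r = 0"
| "comm_length (Alice f t0 t1) x y r =
     Suc (if f x r then comm_length t1 x y r else comm_length t0 x y r)"
| "comm_length (Bob f t0 t1) x y r =
     Suc (if f y r then comm_length t1 x y r else comm_length t0 x y r)"

definition public_coins :: "nat \<Rightarrow> bool list pmf" where
  "public_coins n = pmf_of_set {r. length r = n}"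

end

(* Nested hashing: Alice reveals a growing prefix of a random hash of x, and Bob stops as soon as
   some sufficiently likely x' is consistent with it. With round length s, the candidate x' is
   admitted in round i(x') = ceiling (log (1 / p(x'|y)) / s), when L + s * i(x') hash bits are known.
   A wrong x' can only be accepted if it agrees with x on these bits, since later prefixes extend
   earlier ones; so the error is at most the sum of 2^-(L + s * i(x')) <= 2^-L * p(x'|y), which is at
   most 2^-L with no loss for the number of rounds. The true x stops the protocol by round i(x),
   and s close to sqrt H balances the overshoot s against the H / s feedback bits. *)

theory Submission
  imports Defs
begin

section \<open>Protocol trees and their runs\<close>

text \<open>A leaf sees only Bob's input and the coins, so the transcript \<open>w\<close> is
  threaded through the construction and the continuation is built from it. Its length is the index
  of the next hash bit.\<close>

primrec send_bits ::
  "('x \<Rightarrow> 'r \<Rightarrow> nat \<Rightarrow> bool) \<Rightarrow> (bool list \<Rightarrow> ('x, 'y, 'r, 'out) protocol) \<Rightarrow> nat \<Rightarrow> bool list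
     \<Rightarrow> ('x, 'y, 'r, 'out) protocol" where
  "send_bits h rest 0 w = rest w"
| "send_bits h rest (Suc d) w =
     Alice (\<lambda>x r. h x r (length w)) (send_bits h rest d (w @ [False])) (send_bits h rest d (w @ [True]))"

definition hash_prefix :: "('x \<Rightarrow> 'r \<Rightarrow> nat \<Rightarrow> bool) \<Rightarrow> 'x \<Rightarrow> 'r \<Rightarrow> nat \<Rightarrow> bool list" where
  "hash_prefix h x r m = map (h x r) [0..<m]"

lemma length_hash_prefix [simp]: "length (hash_prefix h x r m) = m"
  by (simp add: hash_prefix_def)

lemma hash_prefix_0 [simp]: "hash_prefix h x r 0 = []"
  by (simp add: hash_prefix_def)

lemma hash_prefix_Suc: "hash_prefix h x r (Suc m) = hash_prefix h x r m @ [h x r m]"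
  by (simp add: hash_prefix_def)

lemma hash_prefix_eq_iff:
  "hash_prefix h x r m = hash_prefix h x' r m \<longleftrightarrow> (\<forall>k<m. h x r k = h x' r k)"
  by (auto simp: hash_prefix_def)

text \<open>Each bit that Alice sends extends the prefix of her own hash, so a run that starts at
  such a prefix passes only through such prefixes.\<close>

lemma bob_output_send_bits:
  "bob_output (send_bits h rest d (hash_prefix h x r m)) x y r
     = bob_output (rest (hash_prefix h x r (m + d))) x y r"
proof (induction d arbitrary: m)
  case (Suc d)
  then show ?case
    using Suc[of "Suc m"] by (cases "h x r m") (simp_all add: hash_prefix_Suc)
qed simp

lemma comm_length_send_bits:
  "comm_length (send_bits h rest d (hash_prefix h x r m)) x y r
     = d + comm_length (rest (hash_prefix h x r (m + d))) x y r"
proof (induction d arbitrary: m)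
  case (Suc d)
  then show ?case
    using Suc[of "Suc m"] by (cases "h x r m") (simp_all add: hash_prefix_Suc)
qed simp

(* "cand y r j w" is the set of inputs of Alice that Bob accepts in round j on the transcript w. *)
primrec guess_rounds ::
  "('x \<Rightarrow> 'r \<Rightarrow> nat \<Rightarrow> bool) \<Rightarrow> ('y \<Rightarrow> 'r \<Rightarrow> nat \<Rightarrow> bool list \<Rightarrow> 'x set) \<Rightarrow> nat \<Rightarrow> nat \<Rightarrow> nat \<Rightarrow> bool list
     \<Rightarrow> ('x, 'y, 'r, 'x) protocol" where
  "guess_rounds h cand s 0 = (\<lambda>j w. Leaf (\<lambda>y r. undefined))"
| "guess_rounds h cand s (Suc N) = (\<lambda>j w.
     Bob (\<lambda>y r. cand y r j w \<noteq> {})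
       (send_bits h (guess_rounds h cand s N (Suc j)) s w)
       (Leaf (\<lambda>y r. SOME x. x \<in> cand y r j w)))"

text \<open>Bob stops in round \<open>i\<close> at the latest, as \<open>x\<close> itself is then a
  candidate. Each failed round costs one feedback bit and \<open>s\<close> hash bits, the accepting
  one a single feedback bit. By \<open>i < j + N\<close> the \<open>undefined\<close> leaf is out of
  reach.\<close>

lemma comm_length_guess_rounds:
  assumes "x \<in> cand y r i (hash_prefix h x r (L + i * s))" "j \<le> i" "i < j + N"
  shows "comm_length (guess_rounds h cand s N j (hash_prefix h x r (L + j * s))) x y r
           \<le> (i - j) * (s + 1) + 1"
  using assms(2,3)
proof (induction N arbitrary: j)
  case (Suc N)
  show ?case
  proof (cases "cand y r j (hash_prefix h x r (L + j * s)) = {}")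
    case True
    with assms(1) Suc.prems have "Suc j \<le> i"
      by (metis empty_iff le_neq_implies_less Suc_leI)
    with Suc.prems Suc.IH[of "Suc j"]
    have "comm_length (guess_rounds h cand s N (Suc j) (hash_prefix h x r (L + Suc j * s))) x y r
            \<le> (i - Suc j) * (s + 1) + 1"
      by simp
    moreover have "i - j = Suc (i - Suc j)"
      using \<open>Suc j \<le> i\<close> by simp
    ultimately show ?thesis
      using True by (simp add: comm_length_send_bits algebra_simps)
  qed simp
qed simp

text \<open>Bob may stop before round \<open>i\<close>, but by the last hypothesis a nonempty
  candidate set on the transcript of \<open>x\<close> is \<open>{x}\<close>, which leaves
  \<open>SOME\<close> no choice.\<close>

lemma bob_output_guess_rounds:
  assumes "x \<in> cand y r i (hash_prefix h x r (L + i * s))" "j \<le> i" "i < j + N"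
    and "\<And>j. cand y r j (hash_prefix h x r (L + j * s)) \<subseteq> {x}"
  shows "bob_output (guess_rounds h cand s N j (hash_prefix h x r (L + j * s))) x y r = x"
  using assms(2,3)
proof (induction N arbitrary: j)
  case (Suc N)
  show ?case
  proof (cases "cand y r j (hash_prefix h x r (L + j * s)) = {}")
    case True
    with assms(1) Suc.prems have "Suc j \<le> i"
      by (metis empty_iff le_neq_implies_less Suc_leI)
    with Suc.prems Suc.IH[of "Suc j"]
    have "bob_output (guess_rounds h cand s N (Suc j) (hash_prefix h x r (L + Suc j * s))) x y r = x"
      by simp
    then show ?thesis
      using True by (simp add: bob_output_send_bits algebra_simps)
  next
    case False
    with assms(4)[of j] have "cand y r j (hash_prefix h x r (L + j * s)) = {x}"
      by blast
    then show ?thesis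
      by simp
  qed
qed simp

section \<open>Uniform coins and hash collisions\<close>

lemma finite_bool_lists_length: "finite {r :: bool list. length r = n}"
  using finite_lists_length_eq[of "UNIV :: bool set" n] by simp

lemma card_bool_lists_length: "card {r :: bool list. length r = n} = 2 ^ n"
  using card_lists_length_eq[of "UNIV :: bool set" n] by simp

lemma bool_lists_length_nonempty: "{r :: bool list. length r = n} \<noteq> {}"
  using length_replicate[of n True] by blast

lemma set_pmf_public_coins: "set_pmf (public_coins n) = {r. length r = n}"
  unfolding public_coins_def
  by (rule set_pmf_of_set[OF bool_lists_length_nonempty finite_bool_lists_length])

(* Flipping coordinate "a m" destroys the m-th agreement only, so each constraint at least halves
   the set. *)
lemma card_agreeing_le:
  fixes a b :: "nat \<Rightarrow> nat"
  assumes "inj_on a {..<m}" "\<And>k. k < m \<Longrightarrow> a k < n" "\<And>k l. k < m \<Longrightarrow> l < m \<Longrightarrow> a k \<noteq> b l"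
  shows "card {r :: bool list. length r = n \<and> (\<forall>k<m. r ! a k = r ! b k)} * 2 ^ m \<le> (2::nat) ^ n"
  using assms
proof (induction m)
  case 0
  then show ?case by (simp add: card_bool_lists_length)
next
  case (Suc m)
  let ?S = "\<lambda>m. {r :: bool list. length r = n \<and> (\<forall>k<m. r ! a k = r ! b k)}"
  let ?flip = "\<lambda>r :: bool list. r[a m := \<not> r ! a m]"
  have fin: "finite (?S k)" for k
    by (rule finite_subset[OF _ finite_bool_lists_length[of n]]) auto
  have am: "a m < n" "a m \<noteq> b m"
    using Suc.prems by auto
  \<comment> \<open>Injectivity of \<open>a\<close> gives the first inequality and disjointness from
    \<open>b\<close> the second, so the flip at \<open>a m\<close> leaves all earlier agreements
    intact.\<close>
  have other: "a m \<noteq> a k" "a m \<noteq> b k" if "k < m" for k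
    using that Suc.prems(3)[of m k] inj_onD[OF Suc.prems(1), of m k]
    by (force, force)
  have "inj_on ?flip (?S (Suc m))"
  proof (rule inj_on_inverseI[where g = ?flip])
    have "?flip (?flip r) = r" if "a m < length r" for r
      using that by simp
    with am show "?flip (?flip r) = r" if "r \<in> ?S (Suc m)" for r
      using that by blast
  qed
  moreover have "?flip ` ?S (Suc m) \<subseteq> ?S m - ?S (Suc m)"
  proof (rule image_subsetI)
    fix r assume r: "r \<in> ?S (Suc m)"
    then have "?flip r \<in> ?S m"
      using other by simp
    moreover have "?flip r ! a m \<noteq> ?flip r ! b m"
      using r am by auto
    then have "?flip r \<notin> ?S (Suc m)"
      by blast
    ultimately show "?flip r \<in> ?S m - ?S (Suc m)" by blast
  qed
  ultimately have "card (?S (Suc m)) \<le> card (?S m - ?S (Suc m))"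
    by (rule card_inj_on_le) (use fin[of m] in blast)
  moreover have sub: "?S (Suc m) \<subseteq> ?S m"
    by auto
  moreover have "card (?S m - ?S (Suc m)) = card (?S m) - card (?S (Suc m))"
    by (rule card_Diff_subset[OF fin sub])
  ultimately have "2 * card (?S (Suc m)) \<le> card (?S m)"
    using card_mono[OF fin sub] by linarith
  then have "2 * card (?S (Suc m)) * 2 ^ m \<le> card (?S m) * 2 ^ m"
    by (rule mult_le_mono1)
  also have "\<dots> \<le> 2 ^ n"
  proof (rule Suc.IH)
    show "inj_on a {..<m}"
      by (rule inj_on_subset[OF Suc.prems(1)]) auto
  qed (use Suc.prems in auto)
  finally show ?case
    by (simp only: power_Suc mult.assoc mult.commute mult.left_commute)
qed

lemma prob_agreeing_le:
  fixes a b :: "nat \<Rightarrow> nat"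
  assumes "inj_on a {..<m}" "\<And>k. k < m \<Longrightarrow> a k < n" "\<And>k l. k < m \<Longrightarrow> l < m \<Longrightarrow> a k \<noteq> b l"
  shows "measure_pmf.prob (public_coins n) {r. \<forall>k<m. r ! a k = r ! b k} \<le> 1 / 2 ^ m"
proof -
  have "{r. length r = n} \<inter> {r. \<forall>k<m. r ! a k = r ! b k}
          = {r :: bool list. length r = n \<and> (\<forall>k<m. r ! a k = r ! b k)}"
    by blast
  moreover have "real (card {r :: bool list. length r = n \<and> (\<forall>k<m. r ! a k = r ! b k)}) * 2 ^ m \<le> 2 ^ n"
    using of_nat_mono[OF card_agreeing_le[OF assms], where 'a = real] by simp
  ultimately show ?thesis
    unfolding public_coins_def measure_pmf_of_set[OF bool_lists_length_nonempty finite_bool_lists_length]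
    by (simp add: card_bool_lists_length field_simps)
qed

(* The coins form a bit matrix, stored row by row: row k holds the k-th hash bits of the inputs below M. *)
definition coin_hash :: "nat \<Rightarrow> nat \<Rightarrow> bool list \<Rightarrow> nat \<Rightarrow> bool" where
  "coin_hash M x r k = r ! (k * M + x)"

text \<open>Columns \<open>x\<close> and \<open>x'\<close> of the matrix share no coin, since
  positions in them differ modulo \<open>M\<close>, and distinct rows give distinct
  positions.\<close>

lemma prob_coin_hash_collision_le:
  assumes "x < M" "x' < M" "x \<noteq> x'" "m \<le> K"
  shows "measure_pmf.prob (public_coins (K * M))
           {r. \<forall>k<m. coin_hash M x r k = coin_hash M x' r k} \<le> 1 / 2 ^ m"
  unfolding coin_hash_def
proof (rule prob_agreeing_le)
  show "inj_on (\<lambda>k. k * M + x) {..<m}"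
    using assms(1) by (auto simp: inj_on_def)
  show "k * M + x < K * M" if "k < m" for k
  proof -
    have "k * M + x < Suc k * M" using assms(1) by simp
    also have "\<dots> \<le> K * M" using that assms(4) by (intro mult_le_mono1) simp
    finally show ?thesis .
  qed
  show "k * M + x \<noteq> l * M + x'" for k l
  proof
    assume "k * M + x = l * M + x'"
    then have "(k * M + x) mod M = (l * M + x') mod M" by simp
    with assms show False by simp
  qed
qed

section \<open>Conditional probabilities\<close>

lemma cond_prob_eq_pmf_div:
  fixes p :: "('a \<times> 'b) pmf"
  shows
  "cond_prob (measure_pmf p) (\<lambda>\<omega>. fst \<omega> = x) (\<lambda>\<omega>. snd \<omega> = y) = pmf p (x, y) / pmf (map_pmf snd p) y"
proof -
  have "{\<omega>. fst \<omega> = x \<and> snd \<omega> = y} = {(x, y)}"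
    by auto
  moreover have "snd -` {y} = {\<omega> :: 'a \<times> 'b. snd \<omega> = y}"
    by auto
  ultimately show ?thesis
    by (simp add: cond_prob_def pmf_map measure_pmf_single)
qed

text \<open>An inequality only: \<open>A\<close> may miss part of the support, and all quotients are
  0 when \<open>y\<close> has probability 0.\<close>

lemma sum_cond_prob_le_1:
  assumes "finite A"
  shows "(\<Sum>x\<in>A. pmf p (x, y) / pmf (map_pmf snd p) y) \<le> 1"
proof -
  have "(\<Sum>x\<in>A. pmf p (x, y)) = (\<Sum>z\<in>(\<lambda>x. (x, y)) ` A. pmf p z)"
    by (subst sum.reindex) (auto simp: inj_on_def)
  also have "\<dots> = measure_pmf.prob p ((\<lambda>x. (x, y)) ` A)"
    by (rule measure_measure_pmf_finite[symmetric]) (use assms in simp)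
  also have "\<dots> \<le> pmf (map_pmf snd p) y"
    unfolding pmf_map by (rule measure_pmf.finite_measure_mono) auto
  finally show ?thesis
    by (simp add: sum_divide_distrib[symmetric] divide_le_eq_1 pmf_nonneg less_le)
qed

lemma expectation_pair_fst:
  fixes f :: "'a \<Rightarrow> real"
  shows "measure_pmf.expectation (pair_pmf p q) (\<lambda>z. f (fst z)) = measure_pmf.expectation p f"
  by (metis integral_map_pmf map_fst_pair_pmf)

section \<open>The nested hashing protocol\<close>

text \<open>The \<open>L\<close> hash bits sent up front control the error; \<open>s\<close> further
  bits follow each failed round.\<close>

locale nested_hashing =
  fixes A B :: "nat set" and p :: "(nat \<times> nat) pmf" and L s :: nat
  assumes fin: "finite A" "finite B" and supp: "set_pmf p \<subseteq> A \<times> B" and s_pos: "0 < s"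
begin

definition c where "c x y = pmf p (x, y) / pmf (map_pmf snd p) y"

definition level where "level x y = nat \<lceil>log 2 (1 / c x y) / s\<rceil>"

text \<open>Inputs serve directly as column indices of the coin matrix, so it has a column for every
  number up to the largest element of \<open>A\<close>.\<close>

definition M where "M = Suc (Max A)"

definition N where "N = Max ((\<lambda>(x, y). level x y) ` (A \<times> B))"

definition coins where "coins = (L + N * s) * M"

definition cand where
  "cand y r j w = {x. (x, y) \<in> set_pmf p \<and> level x y \<le> j \<and> hash_prefix (coin_hash M) x r (length w) = w}"

text \<open>Rounds are numbered from 0 to \<open>N\<close>, hence the count \<open>Suc N\<close>;
  round 0 comes right after the initial \<open>L\<close> bits.\<close>

definition hashing_protocol :: "(nat, nat, bool list, nat) protocol" where
  "hashing_protocol = send_bits (coin_hash M) (guess_rounds (coin_hash M) cand s (Suc N) 0) L []"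

lemma c_pos: "0 < c x y" and c_le_1: "c x y \<le> 1" if "(x, y) \<in> set_pmf p"
proof -
  have y: "y \<in> set_pmf (map_pmf snd p)"
    using that by force
  with that show "0 < c x y"
    by (simp only: c_def pmf_positive divide_pos_pos)
  show "c x y \<le> 1"
    using sum_cond_prob_le_1[of "{x}" p y] by (simp add: c_def)
qed

lemma log_inverse_c_nonneg: "0 \<le> log 2 (1 / c x y)" if "(x, y) \<in> set_pmf p"
  using c_pos[OF that] c_le_1[OF that] by simp

lemma level_le: "level x y \<le> N" if "(x, y) \<in> set_pmf p"
  unfolding N_def using that supp fin by (intro Max_ge) force+

lemma less_M: "x < M" if "(x, y) \<in> set_pmf p"
  using that supp fin by (auto simp: M_def less_Suc_eq_le intro!: Max_ge)

text \<open>Rounding up in \<open>level\<close> ensures that the hash bits sent by the round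
  admitting \<open>x\<close> pay for its conditional probability in the union bound.\<close>

lemma power_level_ge: "1 / 2 ^ (level x y * s) \<le> c x y" if "(x, y) \<in> set_pmf p"
proof -
  have "log 2 (1 / c x y) / s \<le> level x y"
    unfolding level_def by (rule real_nat_ceiling_ge)
  then have "log 2 (1 / c x y) \<le> level x y * s"
    using s_pos by (simp add: field_simps)
  then have "1 / c x y \<le> 2 powr (level x y * s)"
    using c_pos[OF that] by (subst (asm) log_le_iff) auto
  also have "\<dots> = 2 ^ (level x y * s)"
    by (metis of_nat_mult powr_realpow zero_less_numeral)
  finally show ?thesis
    using c_pos[OF that] by (simp add: field_simps)
qed

lemma in_cand_level: "x \<in> cand y r (level x y) (hash_prefix (coin_hash M) x r m)"
  if "(x, y) \<in> set_pmf p"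
  using that by (simp add: cand_def)

section \<open>Error probability\<close>

lemma bob_output_hashing_protocol:
  assumes "(x, y) \<in> set_pmf p"
    and "\<And>x'. (x', y) \<in> set_pmf p \<Longrightarrow> x' \<noteq> x \<Longrightarrow>
           \<not> (\<forall>k < L + level x' y * s. coin_hash M x r k = coin_hash M x' r k)"
  shows "bob_output hashing_protocol x y r = x"
proof -
  have "x' = x" if "x' \<in> cand y r j (hash_prefix (coin_hash M) x r (L + j * s))" for x' j
  proof (rule ccontr)
    assume "x' \<noteq> x"
    have x': "(x', y) \<in> set_pmf p" "level x' y \<le> j"
      and "\<forall>k < L + j * s. coin_hash M x r k = coin_hash M x' r k"
      using that by (auto simp: cand_def hash_prefix_eq_iff)
    moreover have "L + level x' y * s \<le> L + j * s"
      using x' by simp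
    ultimately show False
      using assms(2) \<open>x' \<noteq> x\<close> by (meson less_le_trans)
  qed
  then have "bob_output (guess_rounds (coin_hash M) cand s (Suc N) 0
               (hash_prefix (coin_hash M) x r (L + 0 * s))) x y r = x"
    using level_le[OF assms(1)] in_cand_level[OF assms(1)]
    by (intro bob_output_guess_rounds[where i = "level x y"]) auto
  then show ?thesis
    by (simp add: hashing_protocol_def bob_output_send_bits[where m = 0, simplified] del: guess_rounds.simps)
qed

text \<open>Union bound over the wrong inputs: each collides with probability at most
  \<open>c x' y / 2 ^ L\<close>, and the weights \<open>c x' y\<close> sum to at most 1.\<close>

lemma prob_bob_output:
  assumes xy: "(x, y) \<in> set_pmf p"
  shows "measure_pmf.prob (public_coins coins) {r. bob_output hashing_protocol x y r = x} \<ge> 1 - 1 / 2 ^ L"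
proof -
  let ?P = "measure_pmf.prob (public_coins coins)"
  let ?X = "{x'. (x', y) \<in> set_pmf p \<and> x' \<noteq> x}"
  let ?E = "\<lambda>x'. {r. \<forall>k < L + level x' y * s. coin_hash M x r k = coin_hash M x' r k}"
  have finX: "finite ?X"
    using fin(1) by (rule finite_subset[rotated]) (use supp in auto)
  have "UNIV - {r. bob_output hashing_protocol x y r = x} \<subseteq> (\<Union>x'\<in>?X. ?E x')"
    using bob_output_hashing_protocol[OF xy] by blast
  then have "?P (UNIV - {r. bob_output hashing_protocol x y r = x}) \<le> ?P (\<Union>x'\<in>?X. ?E x')"
    by (intro measure_pmf.finite_measure_mono) auto
  also have "\<dots> \<le> (\<Sum>x'\<in>?X. ?P (?E x'))"
    by (rule measure_pmf.finite_measure_subadditive_finite) (use finX in auto)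
  also have "\<dots> \<le> (\<Sum>x'\<in>?X. c x' y / 2 ^ L)"
  proof (rule sum_mono)
    fix x' assume x': "x' \<in> ?X"
    \<comment> \<open>Since \<open>level x' y\<close> is at most \<open>N\<close>, the coin matrix
      has a row for every bit compared.\<close>
    have "?P (?E x') \<le> 1 / 2 ^ (L + level x' y * s)"
      unfolding coins_def
      using x' xy level_le[of x' y] by (intro prob_coin_hash_collision_le less_M) auto
    also have "\<dots> = (1 / 2 ^ (level x' y * s)) / 2 ^ L"
      by (simp add: power_add)
    also have "\<dots> \<le> c x' y / 2 ^ L"
      using x' by (intro divide_right_mono power_level_ge) auto
    finally show "?P (?E x') \<le> c x' y / 2 ^ L" .
  qed
  also have "\<dots> = (\<Sum>x'\<in>?X. c x' y) / 2 ^ L"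
    by (rule sum_divide_distrib[symmetric])
  also have "\<dots> \<le> 1 / 2 ^ L"
    unfolding c_def by (intro divide_right_mono sum_cond_prob_le_1 finX) simp
  finally show ?thesis
    using measure_pmf.prob_compl[of "{r. bob_output hashing_protocol x y r = x}" "public_coins coins"]
    by simp
qed

section \<open>Expected communication\<close>

text \<open>The ceiling in \<open>level\<close> adds at most one round, of cost
  \<open>s + 1\<close>; the accepting feedback bit adds 1. The bound holds for every coin
  string.\<close>

lemma comm_length_hashing_protocol:
  assumes xy: "(x, y) \<in> set_pmf p"
  shows "real (comm_length hashing_protocol x y r) \<le> L + s + 2 + (1 + 1 / s) * log 2 (1 / c x y)"
proof -
  have "comm_length (guess_rounds (coin_hash M) cand s (Suc N) 0
               (hash_prefix (coin_hash M) x r (L + 0 * s))) x y r \<le> (level x y - 0) * (s + 1) + 1"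
    using level_le[OF xy] in_cand_level[OF xy]
    by (intro comm_length_guess_rounds) auto
  then have "comm_length hashing_protocol x y r \<le> L + level x y * (s + 1) + 1"
    by (simp add: hashing_protocol_def comm_length_send_bits[where m = 0, simplified] del: guess_rounds.simps)
  then have "real (comm_length hashing_protocol x y r) \<le> real (L + level x y * (s + 1) + 1)"
    by (rule of_nat_mono)
  also have "\<dots> = L + level x y * (real s + 1) + 1"
    by (simp add: algebra_simps)
  also have "\<dots> \<le> L + (log 2 (1 / c x y) / s + 1) * (real s + 1) + 1"
  proof -
    have "level x y \<le> log 2 (1 / c x y) / s + 1"
    proof -
      have "0 \<le> log 2 (1 / c x y) / s"
        using log_inverse_c_nonneg[OF xy] by simp
      then show ?thesis
        unfolding level_def by linarith
    qed
    then show ?thesis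
      by (intro add_mono mult_right_mono) auto
  qed
  also have "\<dots> = L + s + 2 + (1 + 1 / s) * log 2 (1 / c x y)"
    using s_pos by (simp add: field_simps)
  finally show ?thesis .
qed

lemma cond_entropy_eq: "cond_entropy A B p = measure_pmf.expectation p (\<lambda>(x, y). log 2 (1 / c x y))"
proof -
  have "measure_pmf.expectation p (\<lambda>(x, y). log 2 (1 / c x y))
          = (\<Sum>z\<in>A \<times> B. pmf p z *\<^sub>R (case z of (x, y) \<Rightarrow> log 2 (1 / c x y)))"
    by (rule integral_measure_pmf) (use fin supp in auto)
  then show ?thesis
    unfolding cond_entropy_def cond_prob_eq_pmf_div c_def
    by (simp add: case_prod_unfold)
qed

lemma cond_entropy_nonneg: "0 \<le> cond_entropy A B p"
  unfolding cond_entropy_eq using log_inverse_c_nonneg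
  by (intro Bochner_Integration.integral_nonneg_AE) (auto simp: AE_measure_pmf_iff)

lemma finite_support: "finite (set_pmf p)"
  using fin supp by (meson finite_SigmaI finite_subset)

text \<open>The pointwise bound depends only on the inputs, so the coins integrate out and linearity
  turns the logarithm into the entropy.\<close>

lemma expectation_comm_length:
  "measure_pmf.expectation (pair_pmf p (public_coins coins))
       (\<lambda>((x, y), r). real (comm_length hashing_protocol x y r))
     \<le> L + s + 2 + (1 + 1 / s) * cond_entropy A B p"
proof -
  let ?g = "\<lambda>(x, y). log 2 (1 / c x y)"
  have fs: "finite (set_pmf (pair_pmf p (public_coins coins)))"
    by (simp add: finite_support set_pmf_public_coins finite_bool_lists_length)
  have "measure_pmf.expectation (pair_pmf p (public_coins coins))
       (\<lambda>((x, y), r). real (comm_length hashing_protocol x y r))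
     \<le> measure_pmf.expectation (pair_pmf p (public_coins coins))
         (\<lambda>z. L + s + 2 + (1 + 1 / s) * ?g (fst z))"
    using comm_length_hashing_protocol
    by (intro integral_mono_AE integrable_measure_pmf_finite fs) (auto simp: AE_measure_pmf_iff)
  also have "\<dots> = measure_pmf.expectation p (\<lambda>z. L + s + 2 + (1 + 1 / s) * ?g z)"
    by (rule expectation_pair_fst)
  also have "\<dots> = L + s + 2 + (1 + 1 / s) * measure_pmf.expectation p ?g"
    by (subst Bochner_Integration.integral_add)
       (auto intro!: integrable_measure_pmf_finite finite_support)
  finally show ?thesis
    unfolding cond_entropy_eq .
qed

end

section \<open>Choice of the parameters\<close>

theorem theorem1:
  "\<exists>C::real. \<forall>(A::nat set) (B::nat set) (p::(nat \<times> nat) pmf) (\<epsilon>::real).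
     finite A \<longrightarrow> finite B \<longrightarrow> set_pmf p \<subseteq> A \<times> B \<longrightarrow> 0 < \<epsilon> \<longrightarrow> \<epsilon> \<le> 1 \<longrightarrow>
     (\<exists>(n::nat) (\<pi>::(nat, nat, bool list, nat) protocol).
        (\<forall>(x, y)\<in>set_pmf p.
           measure_pmf.prob (public_coins n) {r. bob_output \<pi> x y r = x} \<ge> 1 - \<epsilon>) \<and>
        measure_pmf.expectation (pair_pmf p (public_coins n))
            (\<lambda>((x, y), r). real (comm_length \<pi> x y r))
          \<le> cond_entropy A B p + 2 * sqrt (cond_entropy A B p) + log 2 (1 / \<epsilon>) + C)"
\<comment> \<open>The constant 4 is 1 for rounding \<open>L\<close>, 1 for rounding
  \<open>s\<close>, and the 2 in the length bound.\<close>
proof (rule exI[of _ 4], intro allI impI)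
  fix A B :: "nat set" and p :: "(nat \<times> nat) pmf" and \<epsilon> :: real
  assume hyps: "finite A" "finite B" "set_pmf p \<subseteq> A \<times> B" and \<epsilon>: "0 < \<epsilon>" "\<epsilon> \<le> 1"
  define H where "H = cond_entropy A B p"
  \<comment> \<open>Lies between \<open>sqrt H\<close> and \<open>sqrt H + 1\<close> and is positive
    even for \<open>H = 0\<close>; the feedback term \<open>H / s\<close> is then at most
    \<open>sqrt H\<close>.\<close>
  define s where "s = Suc (nat \<lfloor>sqrt H\<rfloor>)"
  \<comment> \<open>The least natural number with \<open>1 / 2 ^ L\<close> at most
    \<epsilon>.\<close>
  define L where "L = nat \<lceil>log 2 (1 / \<epsilon>)\<rceil>"
  interpret nested_hashing A B p L s
    using hyps by unfold_locales (auto simp: s_def)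
  have "H \<ge> 0"
    unfolding H_def by (rule cond_entropy_nonneg)
  have L_ge: "log 2 (1 / \<epsilon>) \<le> L"
    unfolding L_def by (rule real_nat_ceiling_ge)
  have L_le: "L \<le> log 2 (1 / \<epsilon>) + 1"
  proof -
    have "0 \<le> log 2 (1 / \<epsilon>)"
      using \<epsilon> by simp
    then show ?thesis
      unfolding L_def by linarith
  qed
  have s_ge: "sqrt H \<le> s" and s_le: "s \<le> sqrt H + 1"
    using \<open>H \<ge> 0\<close> by (simp_all add: s_def) linarith+
  have "1 / \<epsilon> \<le> 2 powr L"
    using L_ge \<epsilon> by (subst (asm) log_le_iff) auto
  then have error: "1 / 2 ^ L \<le> \<epsilon>"
    using \<epsilon> by (simp add: powr_realpow field_simps)
  have "H = sqrt H * sqrt H"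
    using \<open>H \<ge> 0\<close> by simp
  also have "\<dots> \<le> sqrt H * s"
    using s_ge \<open>H \<ge> 0\<close> by (intro mult_left_mono) auto
  finally have "H / s \<le> sqrt H"
    using s_pos by (simp add: field_simps)
  then have "L + s + 2 + (1 + 1 / s) * H \<le> H + 2 * sqrt H + log 2 (1 / \<epsilon>) + 4"
    using L_le s_le by (simp add: algebra_simps)
  then have "measure_pmf.expectation (pair_pmf p (public_coins coins))
               (\<lambda>((x, y), r). real (comm_length hashing_protocol x y r))
             \<le> H + 2 * sqrt H + log 2 (1 / \<epsilon>) + 4"
    using expectation_comm_length unfolding H_def by linarith
  moreover have "\<forall>(x, y)\<in>set_pmf p.
      measure_pmf.prob (public_coins coins) {r. bob_output hashing_protocol x y r = x} \<ge> 1 - \<epsilon>"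
    using prob_bob_output error by force
  ultimately show "\<exists>n (\<pi>::(nat, nat, bool list, nat) protocol).
      (\<forall>(x, y)\<in>set_pmf p. measure_pmf.prob (public_coins n) {r. bob_output \<pi> x y r = x} \<ge> 1 - \<epsilon>) \<and>
      measure_pmf.expectation (pair_pmf p (public_coins n))
          (\<lambda>((x, y), r). real (comm_length \<pi> x y r))
        \<le> cond_entropy A B p + 2 * sqrt (cond_entropy A B p) + log 2 (1 / \<epsilon>) + 4"
    unfolding H_def by blast
qed

end
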